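(* Let $\alpha\in(0,1)$ be irrational, and let $\widetilde J_0(\cos\pi\alpha)$ be the operator in $\ell^2$ generated by the shifted Darboux transformation at the point $\cos\pi\alpha$ of the Jacobi matrix $J_0$ with zero diagonal, first off-diagonal entry $\frac1{\sqrt2}$ and all other off-diagonal entries $\frac12$. Let $G$ be the associated diagonal sign matrix. Then the operator $\widetilde J_0(\cos\pi\alpha)$ is self-adjoint in the Krein space $\ell^2(G)$. Moreover, the operator $\widetilde J_0(\cos\pi\alpha)-\cos\pi\alpha\, I$ is non-negative in $\ell^2(G)$, that is, $$\left[\left(\widetilde J_0(\cos\pi\alpha)-\cos\pi\alpha\, I\right)f,f\right]\ge 0$$ for any $f$ from the domain of $\widetilde J_0(\cos\pi\alpha)$.
   Context: All matrices are semi-infinite, indexed by $\{0,1,2,\dots\}$; $\ell^2$ is the Hilbert space of square summable complex sequences. Here $J_0=\begin{pmatrix}0&\frac1{\sqrt2}&0&\cdots\\ \frac1{\sqrt2}&0&\frac12&\\ 0&\frac12&0&\ddots\\ \vdots&&\ddots&\ddots\end{pmatrix}$. Since $\alpha$ is irrational, there is a unique factorization $J_0-\cos\pi\alpha\, I=LGL^{\top}$, where $G=\operatorname{diag}(\varepsilon_0,\varepsilon_1,\dots)$ with $\varepsilon_j\in\{+1,-1\}$ and $L$ is a real lower bidiagonal matrix with positive diagonal entries. The shifted Darboux transformation is the tridiagonal matrix $\widetilde J_0(\cos\pi\alpha)=GL^{\top}L+\cos\pi\alpha\, I$. The operator generated by a tridiagonal matrix in $\ell^2$ (denoted by the same symbol)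 is the closure of the operator acting by matrix multiplication on finitely supported sequences. The Krein space $\ell^2(G)$ is the linear space $\ell^2$ equipped with the inner product $[f,g]=(Gf,g)_{\ell^2}$; its norm is the norm of $\ell^2$. A densely defined operator $A$ is self-adjoint in $\ell^2(G)$ if it equals its adjoint with respect to $[\cdot,\cdot]$, equivalently, if $GA$ is self-adjoint in $\ell^2$. *)

theory Defs
  imports "HOL-Analysis.Analysis" "HOL-Library.Nonpos_Ints"
begin

section \<open>The space of square summable complex sequences\<close>

typedef ell2 = "{f :: nat \<Rightarrow> complex. summable (\<lambda>n. (cmod (f n))\<^sup>2)}"
  morphisms seq Abs_ell2
  by (rule exI[of _ "\<lambda>_. 0"]) simp

setup_lifting type_definition_ell2

lemma summable_seq: "summable (\<lambda>n. (cmod (seq f n))\<^sup>2)"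
  using seq[of f] by simp

lemma summable_cmod_mult:
  assumes "summable (\<lambda>n. (cmod (f n))\<^sup>2)" "summable (\<lambda>n. (cmod (g n))\<^sup>2)"
  shows "summable (\<lambda>n. cmod (f n) * cmod (g n))"
proof (rule summable_comparison_test'[where N = 0])
  show "summable (\<lambda>n. (cmod (f n))\<^sup>2 + (cmod (g n))\<^sup>2)"
    by (intro summable_add assms)
  fix n
  have "2 * (cmod (f n) * cmod (g n)) \<le> (cmod (f n))\<^sup>2 + (cmod (g n))\<^sup>2"
    using sum_squares_bound[of "cmod (f n)" "cmod (g n)"] by simp
  moreover have "0 \<le> cmod (f n) * cmod (g n)" by simp
  ultimately show "norm (cmod (f n) * cmod (g n)) \<le> (cmod (f n))\<^sup>2 + (cmod (g n))\<^sup>2"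
    unfolding real_norm_def by linarith
qed

lemma square_summable_add:
  assumes "summable (\<lambda>n. (cmod (f n))\<^sup>2)" "summable (\<lambda>n. (cmod (g n))\<^sup>2)"
  shows "summable (\<lambda>n. (cmod (f n + g n))\<^sup>2)"
proof (rule summable_comparison_test'[where N = 0])
  show "summable (\<lambda>n. (cmod (f n))\<^sup>2 + (cmod (g n))\<^sup>2 + 2 * (cmod (f n) * cmod (g n)))"
    by (intro summable_add summable_mult assms summable_cmod_mult)
  fix n
  have "(cmod (f n + g n))\<^sup>2 \<le> (cmod (f n) + cmod (g n))\<^sup>2"
    by (intro power_mono norm_triangle_ineq) simp
  then show "norm ((cmod (f n + g n))\<^sup>2)
      \<le> (cmod (f n))\<^sup>2 + (cmod (g n))\<^sup>2 + 2 * (cmod (f n) * cmod (g n))"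
    by (simp add: power2_sum)
qed

text \<open>
  The class \<open>real_inner\<close> asks for a real inner product, so \<open>\<bullet>\<close> is the real part of the usual
  complex inner product. It induces the usual norm, and hence the usual topology, of the
  complex Hilbert space; sesquilinear forms are given by \<open>krein_inner\<close> below.
\<close>

instantiation ell2 :: real_inner
begin

lift_definition zero_ell2 :: ell2 is "\<lambda>_. 0" by simp
lift_definition plus_ell2 :: "ell2 \<Rightarrow> ell2 \<Rightarrow> ell2" is "\<lambda>f g n. f n + g n"
  by (rule square_summable_add)
lift_definition uminus_ell2 :: "ell2 \<Rightarrow> ell2" is "\<lambda>f n. - f n" by simp
lift_definition minus_ell2 :: "ell2 \<Rightarrow> ell2 \<Rightarrow> ell2" is "\<lambda>f g n. f n - g n"
  subgoal for f g using square_summable_add[of f "\<lambda>n. - g n"] by simp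
  done
lift_definition scaleR_ell2 :: "real \<Rightarrow> ell2 \<Rightarrow> ell2" is "\<lambda>r f n. r *\<^sub>R f n"
  by (simp add: power_mult_distrib summable_mult)

definition inner_ell2 :: "ell2 \<Rightarrow> ell2 \<Rightarrow> real"
  where "inner_ell2 f g = (\<Sum>n. Re (seq f n * cnj (seq g n)))"
definition norm_ell2 :: "ell2 \<Rightarrow> real"
  where "norm_ell2 f = sqrt (\<Sum>n. (cmod (seq f n))\<^sup>2)"
definition dist_ell2 :: "ell2 \<Rightarrow> ell2 \<Rightarrow> real"
  where "dist_ell2 f g = norm (f - g)"
definition sgn_ell2 :: "ell2 \<Rightarrow> ell2"
  where "sgn_ell2 f = inverse (norm f) *\<^sub>R f"
definition uniformity_ell2 :: "(ell2 \<times> ell2) filter"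
  where "uniformity_ell2 = (INF e\<in>{0 <..}. principal {(x, y). dist x y < e})"
definition open_ell2 :: "ell2 set \<Rightarrow> bool"
  where "open_ell2 U =
    (\<forall>x\<in>U. eventually (\<lambda>(x', y). x' = x \<longrightarrow> y \<in> U) uniformity)"

instance
proof
  have summable_inner: "summable (\<lambda>n. Re (seq f n * cnj (seq g n)))" for f g
  proof (rule summable_comparison_test'[where N = 0])
    show "summable (\<lambda>n. cmod (seq f n) * cmod (seq g n))"
      by (intro summable_cmod_mult summable_seq)
    show "norm (Re (seq f n * cnj (seq g n))) \<le> cmod (seq f n) * cmod (seq g n)" for n
      using abs_Re_le_cmod[of "seq f n * cnj (seq g n)"] by (simp add: norm_mult)
  qed
  have inner_self: "inner f f = (\<Sum>n. (cmod (seq f n))\<^sup>2)" for f :: ell2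
    unfolding inner_ell2_def by (simp add: complex_mult_cnj cmod_power2 flip: power2_eq_square)
  fix f g h :: ell2 and r s :: real
  show "f + g + h = f + (g + h)" by transfer (simp add: add.assoc)
  show "f + g = g + f" by transfer (simp add: add.commute)
  show "0 + f = f" by transfer simp
  show "- f + f = 0" by transfer simp
  show "f - g = f + - g" by transfer simp
  show "r *\<^sub>R (f + g) = r *\<^sub>R f + r *\<^sub>R g" by transfer (simp add: scaleR_right_distrib)
  show "(r + s) *\<^sub>R f = r *\<^sub>R f + s *\<^sub>R f" by transfer (simp add: scaleR_left_distrib)
  show "r *\<^sub>R s *\<^sub>R f = (r * s) *\<^sub>R f" by transfer simp
  show "1 *\<^sub>R f = f" by transfer simp
  show "dist f g = norm (f - g)" by (rule dist_ell2_def)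
  show "sgn f = inverse (norm f) *\<^sub>R f" by (rule sgn_ell2_def)
  show "(uniformity :: (ell2 \<times> ell2) filter) = (INF e\<in>{0 <..}. principal {(x, y). dist x y < e})"
    by (rule uniformity_ell2_def)
  show "open U = (\<forall>x\<in>U. eventually (\<lambda>(x', y). x' = x \<longrightarrow> y \<in> U) uniformity)" for U :: "ell2 set"
    by (rule open_ell2_def)
  show "inner f g = inner g f"
    unfolding inner_ell2_def by (simp add: mult.commute)
  show "inner (f + g) h = inner f h + inner g h"
    unfolding inner_ell2_def plus_ell2.rep_eq distrib_right plus_complex.sel
    by (intro suminf_add[symmetric] summable_inner)
  show "inner (r *\<^sub>R f) g = r * inner f g"
  proof -
    have "inner (r *\<^sub>R f) g = (\<Sum>n. r * Re (seq f n * cnj (seq g n)))"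
      unfolding inner_ell2_def scaleR_ell2.rep_eq by (simp add: algebra_simps)
    then show ?thesis
      unfolding inner_ell2_def using suminf_mult[OF summable_inner, of r f g] by (rule trans)
  qed
  show "0 \<le> inner f f"
    unfolding inner_self by (intro suminf_nonneg summable_seq) simp
  show "inner f f = 0 \<longleftrightarrow> f = 0"
  proof -
    have "inner f f = 0 \<longleftrightarrow> (\<forall>n. (cmod (seq f n))\<^sup>2 = 0)"
      unfolding inner_self by (intro suminf_eq_zero_iff summable_seq) simp
    also have "\<dots> \<longleftrightarrow> f = 0"
      by (simp add: zero_ell2.rep_eq fun_eq_iff flip: seq_inject)
    finally show ?thesis .
  qed
  show "norm f = sqrt (inner f f)"
    unfolding inner_self norm_ell2_def ..
qed

end

section \<open>Semi-infinite matrices\<close>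

type_synonym smat = "nat \<Rightarrow> nat \<Rightarrow> real"

text \<open>
  For the banded matrices considered here, and for finitely supported vectors, the following
  series have only finitely many nonzero terms.
\<close>

definition mmult :: "smat \<Rightarrow> smat \<Rightarrow> smat"  (infixl "\<star>" 70)
  where "(A \<star> B) i j = (\<Sum>k. A i k * B k j)"

definition mtranspose :: "smat \<Rightarrow> smat"
  where "mtranspose A i j = A j i"

definition scalar_mat :: "real \<Rightarrow> smat"
  where "scalar_mat c i j = (if i = j then c else 0)"

definition madd :: "smat \<Rightarrow> smat \<Rightarrow> smat"
  where "madd A B i j = A i j + B i j"

definition mdiff :: "smat \<Rightarrow> smat \<Rightarrow> smat"
  where "mdiff A B i j = A i j - B i j"

definition mapply :: "smat \<Rightarrow> (nat \<Rightarrow> complex) \<Rightarrow> nat \<Rightarrow> complex"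
  where "mapply A f i = (\<Sum>j. complex_of_real (A i j) * f j)"

definition lower_bidiagonal :: "smat \<Rightarrow> bool"
  where "lower_bidiagonal L \<longleftrightarrow> (\<forall>i j. i \<noteq> j \<and> i \<noteq> Suc j \<longrightarrow> L i j = 0)"

definition sign_matrix :: "smat \<Rightarrow> bool"
  where "sign_matrix G \<longleftrightarrow> (\<forall>i. G i i = 1 \<or> G i i = - 1) \<and> (\<forall>i j. i \<noteq> j \<longrightarrow> G i j = 0)"

definition J0 :: smat
  where "J0 i j = (if i = Suc j \<or> j = Suc i then (if min i j = 0 then 1 / sqrt 2 else 1 / 2) else 0)"

definition LGL_factorization :: "smat \<Rightarrow> real \<Rightarrow> smat \<Rightarrow> smat \<Rightarrow> bool"
  where "LGL_factorization J x L G \<longleftrightarrow>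
    lower_bidiagonal L \<and> (\<forall>i. L i i > 0) \<and> sign_matrix G \<and>
    mdiff J (scalar_mat x) = L \<star> G \<star> mtranspose L"

definition shifted_Darboux :: "real \<Rightarrow> smat \<Rightarrow> smat \<Rightarrow> smat"
  where "shifted_Darboux x L G = madd (G \<star> mtranspose L \<star> L) (scalar_mat x)"

section \<open>Operators\<close>

text \<open>
  An operator, possibly unbounded, is represented by its graph, and its closure is the
  topological closure of the graph.
\<close>

type_synonym ell2_operator = "(ell2 \<times> ell2) set"

definition generated_operator :: "smat \<Rightarrow> ell2_operator"
  where "generated_operator A =
    closure {(f, g). finite {n. seq f n \<noteq> 0} \<and> seq g = mapply A (seq f)}"

definition shift_operator :: "ell2_operator \<Rightarrow> real \<Rightarrow> ell2_operator"
  where "shift_operator T c = {(f, g - c *\<^sub>R f) | f g. (f, g) \<in> T}"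

text \<open>The indefinite inner product \<open>[f, g] = (G f, g)\<close>, linear in the first argument.\<close>

definition krein_inner :: "smat \<Rightarrow> ell2 \<Rightarrow> ell2 \<Rightarrow> complex"
  where "krein_inner G f g = (\<Sum>n. mapply G (seq f) n * cnj (seq g n))"

definition krein_adjoint :: "smat \<Rightarrow> ell2_operator \<Rightarrow> ell2_operator"
  where "krein_adjoint G T =
    {(g, h). \<forall>(f, k)\<in>T. krein_inner G k g = krein_inner G f h}"

text \<open>
  Complex linearity of \<open>T\<close> needs no separate clause: for a sign matrix \<open>G\<close> it follows from
  \<open>T = krein_adjoint G T\<close>.
\<close>

definition krein_self_adjoint :: "smat \<Rightarrow> ell2_operator \<Rightarrow> bool"
  where "krein_self_adjoint G T \<longleftrightarrow>
    single_valued T \<and> closure (Domain T) = UNIV \<and> T = krein_adjoint G T"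

text \<open>Membership in \<open>\<real>\<^sub>\<ge>\<^sub>0\<close> says that the complex number is real and non-negative.\<close>

definition krein_nonneg :: "smat \<Rightarrow> ell2_operator \<Rightarrow> bool"
  where "krein_nonneg G T \<longleftrightarrow> (\<forall>(f, g)\<in>T. krein_inner G g f \<in> \<real>\<^sub>\<ge>\<^sub>0)"

section \<open>Existence and uniqueness of the factorization\<close>

lemma LGL_entry:
  assumes L: "lower_bidiagonal L" and G: "sign_matrix G"
  shows "(L \<star> G \<star> mtranspose L) i j = (\<Sum>k\<le>i. L i k * G k k * L j k)"
proof -
  have z: "G a b = 0" if "a \<noteq> b" for a b
    using G that by (simp add: sign_matrix_def)
  have LG: "(L \<star> G) i k = L i k * G k k" for k
    unfolding mmult_def by (subst suminf_finite[of "{k}"]) (auto simp: z)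
  have "L i k = 0" if "k > i" for k
    using L that by (auto simp: lower_bidiagonal_def)
  then show ?thesis
    unfolding mmult_def[of "L \<star> G"] mtranspose_def LG
    by (intro suminf_finite) auto
qed

lemma LGL_entries:
  assumes L: "lower_bidiagonal L" and G: "sign_matrix G"
  defines "M \<equiv> L \<star> G \<star> mtranspose L"
  shows "M 0 0 = (L 0 0)\<^sup>2 * G 0 0"
    and "M (Suc i) (Suc i) = (L (Suc i) i)\<^sup>2 * G i i + (L (Suc i) (Suc i))\<^sup>2 * G (Suc i) (Suc i)"
    and "M (Suc i) i = L (Suc i) i * G i i * L i i"
    and "M i (Suc i) = L (Suc i) i * G i i * L i i"
    and "i \<noteq> j \<Longrightarrow> i \<noteq> Suc j \<Longrightarrow> j \<noteq> Suc i \<Longrightarrow> M i j = 0"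
proof -
  have z: "L a b = 0" if "a \<noteq> b" "a \<noteq> Suc b" for a b
    using L that by (simp add: lower_bidiagonal_def)
  have z'': "(\<Sum>k<i. L i' k * G k k * L (Suc i) k) = 0"
      "(\<Sum>k<i. L (Suc i) k * G k k * L i' k) = 0" for i i'
    by (auto intro!: sum.neutral simp: z)
  note e = LGL_entry[OF L G, folded M_def]
  show "M 0 0 = (L 0 0)\<^sup>2 * G 0 0"
    by (simp add: e power2_eq_square)
  show "M (Suc i) (Suc i) = (L (Suc i) i)\<^sup>2 * G i i + (L (Suc i) (Suc i))\<^sup>2 * G (Suc i) (Suc i)"
    by (simp add: e z'' lessThan_Suc flip: lessThan_Suc_atMost)
       (simp add: power2_eq_square algebra_simps)
  show "M (Suc i) i = L (Suc i) i * G i i * L i i"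
    by (simp add: e z'' z lessThan_Suc flip: lessThan_Suc_atMost)
  show "M i (Suc i) = L (Suc i) i * G i i * L i i"
    by (simp add: e z'' z lessThan_Suc flip: lessThan_Suc_atMost)
  show "M i j = 0" if "i \<noteq> j" "i \<noteq> Suc j" "j \<noteq> Suc i"
  proof -
    have "L i k * G k k * L j k = 0" for k
      using that z[of i k] z[of j k] by auto
    then show ?thesis unfolding e by (intro sum.neutral) blast
  qed
qed

lemma J0_entries:
  "J0 i i = 0" "J0 (Suc i) i = (if i = 0 then 1 / sqrt 2 else 1 / 2)"
  "J0 i (Suc i) = (if i = 0 then 1 / sqrt 2 else 1 / 2)"
  "i \<noteq> Suc j \<Longrightarrow> j \<noteq> Suc i \<Longrightarrow> J0 i j = 0"
  by (auto simp: J0_def)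

lemma LGL_factorization_J0_iff:
  "LGL_factorization J0 x L G \<longleftrightarrow>
    lower_bidiagonal L \<and> (\<forall>i. L i i > 0) \<and> sign_matrix G \<and>
    (L 0 0)\<^sup>2 * G 0 0 = - x \<and>
    (\<forall>i. (L (Suc i) i)\<^sup>2 * G i i + (L (Suc i) (Suc i))\<^sup>2 * G (Suc i) (Suc i) = - x) \<and>
    (\<forall>i. L (Suc i) i * G i i * L i i = J0 (Suc i) i)"
proof (cases "lower_bidiagonal L \<and> sign_matrix G")
  case True
  then have L: "lower_bidiagonal L" and G: "sign_matrix G" by auto
  let ?M = "L \<star> G \<star> mtranspose L" and ?N = "mdiff J0 (scalar_mat x)"
  have N: "?N 0 0 = - x" "?N (Suc i) (Suc i) = - x" "?N (Suc i) i = J0 (Suc i) i"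
    "?N i (Suc i) = J0 (Suc i) i"
    "i \<noteq> j \<Longrightarrow> i \<noteq> Suc j \<Longrightarrow> j \<noteq> Suc i \<Longrightarrow> ?N i j = 0" for i j
    by (auto simp: mdiff_def scalar_mat_def J0_entries)
  have "?N = ?M \<longleftrightarrow> ?N 0 0 = ?M 0 0 \<and> (\<forall>i. ?N (Suc i) (Suc i) = ?M (Suc i) (Suc i)) \<and>
      (\<forall>i. ?N (Suc i) i = ?M (Suc i) i)"
  proof
    assume a: "?N 0 0 = ?M 0 0 \<and> (\<forall>i. ?N (Suc i) (Suc i) = ?M (Suc i) (Suc i)) \<and>
      (\<forall>i. ?N (Suc i) i = ?M (Suc i) i)"
    have "?N i j = ?M i j" for i j
    proof -
      consider "i = j" | "i = Suc j" | "j = Suc i" | "i \<noteq> j" "i \<noteq> Suc j" "j \<noteq> Suc i" by blast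
      then show ?thesis
      proof cases
        case 1 with a show ?thesis by (cases i) auto
      next
        case 2 with a show ?thesis by auto
      next
        case 3
        have "?N (Suc i) i = ?M (Suc i) i" using a by blast
        then show ?thesis
          unfolding 3 N(3,4) LGL_entries(3,4)[OF L G] .
      next
        case 4 then show ?thesis using N(5) LGL_entries(5)[OF L G] by simp
      qed
    qed
    then show "?N = ?M" by (intro ext)
  qed simp
  then show ?thesis
    unfolding LGL_factorization_def N(1-3) LGL_entries(1-3)[OF L G] using True by metis
qed (auto simp: LGL_factorization_def)

lemma cos_irrational_nonzero:
  assumes "\<alpha> \<notin> \<rat>" "n > 0"
  shows "cos (real n * (pi * \<alpha>)) \<noteq> 0"
proof
  assume "cos (real n * (pi * \<alpha>)) = 0"
  then obtain k where "real n * (pi * \<alpha>) = of_int k * (pi / 2)"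
    by (auto simp: cos_zero_iff_int)
  then have "\<alpha> = of_int k / (2 * of_nat n)"
    using assms(2) by (simp add: field_simps)
  then have "\<alpha> \<in> \<rat>" by simp
  with assms(1) show False by contradiction
qed

theorem ex1_LGL_factorization_J0:
  assumes "\<alpha> \<notin> \<rat>"
  shows "\<exists>!(L, G). LGL_factorization J0 (cos (pi * \<alpha>)) L G"
proof -
  let ?x = "cos (pi * \<alpha>)"
  define c where "c n = cos (real n * (pi * \<alpha>))" for n
  have c: "c n \<noteq> 0" for n
    using cos_irrational_nonzero[OF assms, of n] by (cases n) (auto simp: c_def)
  have crec: "c (Suc (Suc n)) = 2 * ?x * c (Suc n) - c n" for n
  proof -
    have "c (Suc (Suc n)) = cos (real (Suc n) * (pi * \<alpha>) + pi * \<alpha>)"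
      "c n = cos (real (Suc n) * (pi * \<alpha>) - pi * \<alpha>)"
      by (simp_all add: c_def algebra_simps)
    then show ?thesis by (simp add: cos_add cos_diff c_def)
  qed
  define d where "d n = (if n = 0 then - ?x else - c (Suc n) / (2 * c n))" for n
  have d: "d n \<noteq> 0" for n
    using c[of 1] c[of n] c[of "Suc n"] by (simp add: d_def c_def)
  have x: "?x = c 1" by (simp add: c_def)
  have drec: "d (Suc n) + (J0 (Suc n) n)\<^sup>2 / d n = - ?x" for n
  proof (cases n)
    case 0
    have "c (Suc (Suc 0)) = 2 * ?x * c (Suc 0) - c 0" by (rule crec)
    then have "c (Suc (Suc 0)) = 2 * c 1 * c 1 - 1" by (simp add: x c_def[of 0])
    with 0 c[of 1] show ?thesis
      by (simp add: d_def J0_entries x power_divide field_simps)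
  next
    case (Suc m)
    have "c (Suc (Suc n)) = 2 * c 1 * c (Suc n) - c n" using crec[of n] x by simp
    with Suc c[of "Suc n"] c[of n] c[of 1] show ?thesis
      by (simp add: d_def J0_entries x power_divide field_simps)
  qed
  define G :: smat where "G i j = (if i = j then sgn (d i) else 0)" for i j
  define L :: smat where "L i j = (if i = j then sqrt \<bar>d i\<bar>
      else if i = Suc j then J0 (Suc j) j * sgn (d j) / sqrt \<bar>d j\<bar> else 0)" for i j
  have "LGL_factorization J0 ?x L G"
    unfolding LGL_factorization_J0_iff
  proof (intro conjI allI)
    show "lower_bidiagonal L" by (auto simp: lower_bidiagonal_def L_def)
    show "sign_matrix G" using d by (auto simp: sign_matrix_def G_def sgn_if)
    show "L i i > 0" for i using d by (simp add: L_def)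
    have LG: "(L i i)\<^sup>2 * G i i = d i" for i
      by (simp add: L_def G_def abs_mult_sgn)
    show "(L 0 0)\<^sup>2 * G 0 0 = - ?x" unfolding LG by (simp add: d_def)
    have "(L (Suc i) i)\<^sup>2 * G i i = (J0 (Suc i) i)\<^sup>2 / d i" for i
      using d[of i] by (auto simp: L_def G_def sgn_if power_divide power_mult_distrib)
    then show "(L (Suc i) i)\<^sup>2 * G i i + (L (Suc i) (Suc i))\<^sup>2 * G (Suc i) (Suc i) = - ?x" for i
      unfolding LG using drec[of i] by simp
    show "L (Suc i) i * G i i * L i i = J0 (Suc i) i" for i
      using d[of i] by (auto simp: L_def G_def sgn_if)
  qed
  moreover have "L' = L'' \<and> G' = G''"
    if f': "LGL_factorization J0 ?x L' G'" and f'': "LGL_factorization J0 ?x L'' G''"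
    for L' G' L'' G''
  proof -
    have eqI: "a = b \<and> s = t"
      if "a\<^sup>2 * s = b\<^sup>2 * t" "a > 0" "b > 0" "s = 1 \<or> s = -1" "t = 1 \<or> t = -1" for a b s t :: real
    proof -
      have "a\<^sup>2 > 0" "b\<^sup>2 > 0" using that by auto
      then have "a\<^sup>2 \<noteq> - b\<^sup>2" "- a\<^sup>2 \<noteq> b\<^sup>2" by linarith+
      with that have "a\<^sup>2 = b\<^sup>2 \<and> s = t" by auto
      with that show ?thesis by (auto simp: power2_eq_iff)
    qed
    note p' = f'[unfolded LGL_factorization_J0_iff] and p'' = f''[unfolded LGL_factorization_J0_iff]
    have s: "G' i i = 1 \<or> G' i i = - 1" "G'' i i = 1 \<or> G'' i i = - 1" for i
      using p' p'' by (auto simp: sign_matrix_def)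
    have pos: "L' i i > 0" "L'' i i > 0" for i using p' p'' by auto
    have off: "L' (Suc i) i = L'' (Suc i) i" if "L' i i = L'' i i" "G' i i = G'' i i" for i
    proof -
      have "L' (Suc i) i * (G' i i * L' i i) = L'' (Suc i) i * (G' i i * L' i i)"
        using p' p'' that by (metis mult.assoc)
      moreover have "G' i i * L' i i \<noteq> 0" using s(1)[of i] pos(1)[of i] by auto
      ultimately show ?thesis by simp
    qed
    have diag: "L' i i = L'' i i \<and> G' i i = G'' i i" for i
    proof (induction i)
      case 0
      show ?case by (rule eqI) (use p' p'' s pos in auto)
    next
      case (Suc i)
      have o: "L' (Suc i) i = L'' (Suc i) i" using off Suc by blast
      have "(L' (Suc i) i)\<^sup>2 * G' i i + (L' (Suc i) (Suc i))\<^sup>2 * G' (Suc i) (Suc i) =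
          (L'' (Suc i) i)\<^sup>2 * G'' i i + (L'' (Suc i) (Suc i))\<^sup>2 * G'' (Suc i) (Suc i)"
        using p' p'' by metis
      then have "(L' (Suc i) (Suc i))\<^sup>2 * G' (Suc i) (Suc i) =
          (L'' (Suc i) (Suc i))\<^sup>2 * G'' (Suc i) (Suc i)"
        using o Suc by simp
      then show ?case by (rule eqI) (use s pos in auto)
    qed
    have "L' i j = L'' i j" for i j
      using diag[of i] diag[of j] off[of j] p' p'' unfolding lower_bidiagonal_def
      by (cases "i = j"; cases "i = Suc j") auto
    moreover have "G' i j = G'' i j" for i j
      using diag[of i] p' p'' unfolding sign_matrix_def by (cases "i = j") auto
    ultimately show ?thesis by (auto simp: fun_eq_iff)
  qed
  ultimately show ?thesis
    by (intro ex1I[of _ "(L, G)"]) auto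
qed

end

theory Submission
  imports Defs
begin

text \<open>
  With \<open>c n = cos (n \<pi> \<alpha>)\<close>, the recurrence for the factorization of \<open>J0\<close> is solved by
  \<open>(L n n)\<^sup>2 * G n n = - c (n + 1) / (2 * c n)\<close> for \<open>n > 0\<close>. Hence the off-diagonal entries of the
  shifted Darboux transformation at position \<open>n\<close> have modulus
  \<open>sqrt \<bar>c n * c (n + 2)\<bar> / (2 * \<bar>c (n + 1)\<bar>)\<close>. They may be unbounded, but their reciprocals dominate
  \<open>\<bar>c (n + 1)\<bar>\<close>, whose sum diverges. By Carleman's condition the closure of the operator on finitely
  supported sequences is therefore the maximal operator, which is the adjoint. Non-negativity is
  \<open>(L\<^sup>T L f, f) = \<parallel>L f\<parallel>\<^sup>2\<close> on finitely supported \<open>f\<close>, extended by continuity.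
\<close>

section \<open>Square summable sequences\<close>

lemma seq_Abs_ell2: "summable (\<lambda>n. (cmod (F n))\<^sup>2) \<Longrightarrow> seq (Abs_ell2 F) = F"
  by (simp add: Abs_ell2_inverse)

lemma seq_Abs_ell2_finite: "finite {n. F n \<noteq> 0} \<Longrightarrow> seq (Abs_ell2 F) = F"
  by (intro seq_Abs_ell2 summable_finite[of "{n. F n \<noteq> 0}"]) auto

lemma seq_Abs_ell2_dominated:
  assumes "\<And>n. cmod (F n) \<le> C * cmod (seq f n)"
  shows "seq (Abs_ell2 F) = F"
proof (rule seq_Abs_ell2, rule summable_comparison_test'[where N = 0])
  show "summable (\<lambda>n. C\<^sup>2 * (cmod (seq f n))\<^sup>2)"
    by (intro summable_mult summable_seq)
  show "norm ((cmod (F n))\<^sup>2) \<le> C\<^sup>2 * (cmod (seq f n))\<^sup>2" for n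
    using power_mono[OF assms[of n], of 2] by (simp add: power_mult_distrib)
qed

lemma norm_ell2_sq: "(norm f)\<^sup>2 = (\<Sum>n. (cmod (seq f n))\<^sup>2)"
  unfolding norm_ell2_def by (intro real_sqrt_pow2 suminf_nonneg summable_seq) simp

text \<open>Turns a pointwise bound with a constant factor into a norm bound; the commutator
  estimate in Carleman's argument needs it with a factor tending to 0.\<close>

lemma norm_ell2_mono:
  assumes "0 \<le> C" "\<And>n. cmod (seq h n) \<le> C * cmod (seq f n)"
  shows "norm h \<le> C * norm f"
proof (rule power2_le_imp_le)
  have "(norm h)\<^sup>2 \<le> (\<Sum>n. C\<^sup>2 * (cmod (seq f n))\<^sup>2)"
    unfolding norm_ell2_sq
  proof (intro suminf_le summable_mult summable_seq)
    show "(cmod (seq h n))\<^sup>2 \<le> C\<^sup>2 * (cmod (seq f n))\<^sup>2" for n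
      using power_mono[OF assms(2)[of n], of 2] by (simp add: power_mult_distrib)
  qed
  also have "\<dots> = (C * norm f)\<^sup>2"
    by (simp add: power_mult_distrib norm_ell2_sq suminf_mult summable_seq)
  finally show "(norm h)\<^sup>2 \<le> (C * norm f)\<^sup>2" .
qed (use assms in simp)

lemma cmod_seq_le_norm: "cmod (seq f n) \<le> norm f"
proof (rule power2_le_imp_le)
  show "(cmod (seq f n))\<^sup>2 \<le> (norm f)\<^sup>2"
    unfolding norm_ell2_sq using sum_le_suminf[OF summable_seq, of "{n}" f] by simp
qed simp

text \<open>Continuity of the coordinate functionals is what makes conditions imposed coordinate by
  coordinate closed in \<open>ell2\<close>.\<close>

lemma bounded_linear_seq: "bounded_linear (\<lambda>f. seq f n)"
  by (rule bounded_linear_intro[where K = 1])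
    (simp_all add: plus_ell2.rep_eq scaleR_ell2.rep_eq cmod_seq_le_norm)

lemmas continuous_on_seq [continuous_intros] =
  bounded_linear.continuous_on[OF bounded_linear_seq]

text \<open>The two shifts carry the neighbours \<open>f (n + 1)\<close> and
  \<open>f (n - 1)\<close> that the off-diagonal entries of a tridiagonal matrix multiply in row
  \<open>n\<close>. Both are contractions, so bounds on the coefficients become norm bounds.\<close>

lift_definition left_shift :: "ell2 \<Rightarrow> ell2" is "\<lambda>f n. f (Suc n)"
  by (simp add: summable_Suc_iff[of "\<lambda>n. (cmod (_ n))\<^sup>2"])

lift_definition right_shift :: "ell2 \<Rightarrow> ell2" is "\<lambda>f n. case n of 0 \<Rightarrow> 0 | Suc m \<Rightarrow> f m"
  by (subst summable_Suc_iff[symmetric]) simp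

lemma norm_left_shift_le: "norm (left_shift f) \<le> norm f"
proof (rule power2_le_imp_le)
  show "(norm (left_shift f))\<^sup>2 \<le> (norm f)\<^sup>2"
    unfolding norm_ell2_sq left_shift.rep_eq using suminf_split_head[OF summable_seq, of f] by simp
qed simp

lemma norm_right_shift: "norm (right_shift f) = norm f"
proof -
  have "(norm (right_shift f))\<^sup>2 = (norm f)\<^sup>2"
    using suminf_split_head[OF summable_seq, of "right_shift f"]
    by (simp add: norm_ell2_sq right_shift.rep_eq)
  then show ?thesis by simp
qed

text \<open>Dominated convergence for series: the factor \<open>(\<phi> N n - 1)\<^sup>2\<close> is
  at most 1 and tends to 0 for each \<open>n\<close>, so the squared moduli of \<open>f\<close>
  dominate. It serves both slowly decaying cutoffs and sharp truncation.\<close>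

lemma cutoff_tendsto:
  fixes \<phi> :: "nat \<Rightarrow> nat \<Rightarrow> real"
  assumes "\<And>N n. 0 \<le> \<phi> N n" "\<And>N n. \<phi> N n \<le> 1" "\<And>n. (\<lambda>N. \<phi> N n) \<longlonglongrightarrow> 1"
    and "\<And>N n. seq (h N) n = of_real (\<phi> N n) * seq f n"
  shows "h \<longlonglongrightarrow> f"
proof -
  have eq: "(cmod (seq (h N - f) n))\<^sup>2 = (\<phi> N n - 1)\<^sup>2 * (cmod (seq f n))\<^sup>2" for N n
  proof -
    have "seq (h N - f) n = of_real (\<phi> N n - 1) * seq f n"
      by (simp add: minus_ell2.rep_eq assms(4) algebra_simps)
    then show ?thesis by (simp only: norm_mult norm_of_real power_mult_distrib power2_abs)
  qed
  have "(\<lambda>N. \<Sum>n. (cmod (seq (h N - f) n))\<^sup>2) \<longlonglongrightarrow> (\<Sum>n. 0)"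
  proof (rule tannerys_theorem[OF _ _ summable_seq[of f], THEN conjunct2, THEN conjunct2])
    show "(\<lambda>N. (cmod (seq (h N - f) n))\<^sup>2) \<longlonglongrightarrow> 0" for n
      unfolding eq using assms(3)[of n] by (auto intro!: tendsto_eq_intros)
    have "(\<phi> N n - 1)\<^sup>2 \<le> 1" for N n
      using assms(1,2)[of N n] by (simp add: abs_square_le_1)
    then show "\<forall>\<^sub>F (n, N) in at_top \<times>\<^sub>F sequentially.
        norm ((cmod (seq (h N - f) n))\<^sup>2) \<le> (cmod (seq f n))\<^sup>2"
      unfolding eq by (intro always_eventually) (auto simp: mult_left_le_one_le abs_mult)
  qed simp
  then have "(\<lambda>N. sqrt ((norm (h N - f))\<^sup>2)) \<longlonglongrightarrow> sqrt 0"
    unfolding norm_ell2_sq by (intro tendsto_real_sqrt) simp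
  then show ?thesis
    by (simp add: tendsto_norm_zero_iff LIM_zero_iff)
qed

section \<open>The Krein inner product\<close>

lemma sign_matrix_diag:
  assumes "sign_matrix G"
  shows "\<bar>G i i\<bar> = 1"
proof -
  have "G i i = 1 \<or> G i i = - 1" using assms by (simp add: sign_matrix_def)
  then show ?thesis by auto
qed

lemma sign_matrix_sq: "sign_matrix G \<Longrightarrow> G i i * G i i = 1"
  using abs_mult_self_eq[of "G i i"] by (simp add: sign_matrix_diag)

lemma mapply_sign_matrix:
  assumes "sign_matrix G"
  shows "mapply G f n = of_real (G n n) * f n"
  unfolding mapply_def using assms by (subst suminf_finite[of "{n}"]) (auto simp: sign_matrix_def)

lemma summable_krein:
  assumes "sign_matrix G"
  shows "summable (\<lambda>n. of_real (G n n) * seq f n * cnj (seq g n))"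
  by (rule summable_norm_cancel)
    (simp add: norm_mult summable_cmod_mult summable_seq sign_matrix_diag[OF assms])

lemma krein_inner_eq:
  assumes "sign_matrix G"
  shows "krein_inner G f g = (\<Sum>n. of_real (G n n) * seq f n * cnj (seq g n))"
  unfolding krein_inner_def by (simp add: mapply_sign_matrix[OF assms])

text \<open>The signs disappear after taking moduli termwise. What remains is the real inner product
  of the sequences of moduli, to which the Cauchy-Schwarz inequality of \<open>real_inner\<close>
  applies.\<close>

lemma cmod_krein_inner_le:
  assumes G: "sign_matrix G"
  shows "cmod (krein_inner G f g) \<le> norm f * norm g"
proof -
  let ?a = "\<lambda>h. Abs_ell2 (\<lambda>n. of_real (cmod (seq h n)))"
  have a: "seq (?a h) = (\<lambda>n. of_real (cmod (seq h n)))" for h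
    by (rule seq_Abs_ell2_dominated[where C = 1 and f = h]) simp
  have na: "norm (?a h) = norm h" for h
    by (simp add: norm_ell2_def a)
  have s: "summable (\<lambda>n. cmod (of_real (G n n) * seq f n * cnj (seq g n)))"
    by (simp add: norm_mult summable_cmod_mult summable_seq sign_matrix_diag[OF G])
  have "cmod (krein_inner G f g) \<le> (\<Sum>n. cmod (of_real (G n n) * seq f n * cnj (seq g n)))"
    unfolding krein_inner_eq[OF G] by (rule summable_norm[OF s])
  also have "\<dots> = inner (?a f) (?a g)"
    by (simp add: inner_ell2_def a norm_mult sign_matrix_diag[OF G])
  also have "\<dots> \<le> norm (?a f) * norm (?a g)"
    by (rule norm_cauchy_schwarz)
  finally show ?thesis unfolding na .
qed

text \<open>Real bilinearity suffices here: its purpose is joint continuity of the form, by which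
  identities and signs pass from finitely supported vectors to closures.\<close>

lemma bounded_bilinear_krein_inner:
  assumes G: "sign_matrix G"
  shows "bounded_bilinear (krein_inner G)"
proof
  note s = summable_krein[OF G]
  fix f g h :: ell2 and r :: real
  show "krein_inner G (f + g) h = krein_inner G f h + krein_inner G g h"
    unfolding krein_inner_eq[OF G]
    by (subst suminf_add[OF s s]) (simp add: plus_ell2.rep_eq algebra_simps)
  show "krein_inner G f (g + h) = krein_inner G f g + krein_inner G f h"
    unfolding krein_inner_eq[OF G]
    by (subst suminf_add[OF s s]) (simp add: plus_ell2.rep_eq algebra_simps)
  show "krein_inner G (r *\<^sub>R f) g = r *\<^sub>R krein_inner G f g"
    unfolding krein_inner_eq[OF G]
    by (subst suminf_scaleR_right[OF s])
      (simp add: scaleR_ell2.rep_eq scaleR_conv_of_real algebra_simps)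
  show "krein_inner G f (r *\<^sub>R g) = r *\<^sub>R krein_inner G f g"
    unfolding krein_inner_eq[OF G]
    by (subst suminf_scaleR_right[OF s])
      (simp add: scaleR_ell2.rep_eq scaleR_conv_of_real algebra_simps)
  show "\<exists>K. \<forall>f g. cmod (krein_inner G f g) \<le> norm f * norm g * K"
    using cmod_krein_inner_le[OF G] by (intro exI[of _ 1]) simp
qed

section \<open>Operators generated by tridiagonal matrices\<close>

definition tridiagonal :: "smat \<Rightarrow> bool"
  where "tridiagonal A \<longleftrightarrow> (\<forall>i j. i \<noteq> j \<and> i \<noteq> Suc j \<and> j \<noteq> Suc i \<longrightarrow> A i j = 0)"

text \<open>The domain is implicit: since \<open>g\<close> has type \<open>ell2\<close>, a vector
  \<open>f\<close> belongs to it exactly when \<open>mapply A (seq f)\<close> is square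
  summable.\<close>

definition maximal_operator :: "smat \<Rightarrow> ell2_operator"
  where "maximal_operator A = {(f, g). seq g = mapply A (seq f)}"

lemma mapply_tridiagonal:
  assumes "tridiagonal A"
  shows "mapply A f i = (\<Sum>j\<le>Suc i. of_real (A i j) * f j)"
  unfolding mapply_def using assms by (intro suminf_finite) (auto simp: tridiagonal_def)

lemma mapply_tridiagonal_Suc:
  assumes "tridiagonal A"
  shows "mapply A f 0 = of_real (A 0 0) * f 0 + of_real (A 0 1) * f 1"
    and "mapply A f (Suc i) = of_real (A (Suc i) i) * f i + of_real (A (Suc i) (Suc i)) * f (Suc i)
      + of_real (A (Suc i) (Suc (Suc i))) * f (Suc (Suc i))"
proof -
  have "(\<Sum>j<i. of_real (A (Suc i) j) * f j) = 0"
    using assms by (intro sum.neutral) (auto simp: tridiagonal_def)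
  then show "mapply A f 0 = of_real (A 0 0) * f 0 + of_real (A 0 1) * f 1"
    and "mapply A f (Suc i) = of_real (A (Suc i) i) * f i + of_real (A (Suc i) (Suc i)) * f (Suc i)
      + of_real (A (Suc i) (Suc (Suc i))) * f (Suc (Suc i))"
    by (simp_all add: mapply_tridiagonal[OF assms] lessThan_Suc flip: lessThan_Suc_atMost)
qed

lemma finite_support_mapply:
  assumes A: "tridiagonal A" and f: "finite {n. f n \<noteq> 0}"
  shows "finite {n. mapply A f n \<noteq> 0}"
proof -
  obtain m where m: "f n = 0" if "n > m" for n
    using f by (auto simp: finite_nat_set_iff_bounded_le not_le[symmetric])
  have "mapply A f n = 0" if "n > Suc m" for n
    unfolding mapply_tridiagonal[OF A] using A that m
    by (intro sum.neutral) (auto simp: tridiagonal_def, metis less_Suc_eq not_less_eq)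
  then have "{n. mapply A f n \<noteq> 0} \<subseteq> {..Suc m}"
    by (metis (mono_tags, lifting) atMost_iff leI mem_Collect_eq subsetI)
  then show ?thesis by (rule finite_subset) simp
qed

text \<open>Each row involves finitely many coordinates, so the graph is an intersection of closed
  sets, one for each row equation.\<close>

lemma closed_maximal_operator:
  assumes A: "tridiagonal A"
  shows "closed (maximal_operator A)"
proof -
  have "maximal_operator A =
      (\<Inter>i. {p. seq (snd p) i = (\<Sum>j\<le>Suc i. of_real (A i j) * seq (fst p) j)})"
    by (auto simp: maximal_operator_def fun_eq_iff mapply_tridiagonal[OF A])
  also have "closed \<dots>"
    by (intro closed_INT ballI closed_Collect_eq continuous_intros)
  finally show ?thesis .
qed

lemma finite_support_in_maximal_operator:
  assumes "tridiagonal A" "finite {n. seq f n \<noteq> 0}"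
  shows "(f, Abs_ell2 (mapply A (seq f))) \<in> maximal_operator A"
  by (simp add: maximal_operator_def seq_Abs_ell2_finite finite_support_mapply assms)

text \<open>
  Carleman's condition, with \<open>w\<close> dominated by the reciprocals of the off-diagonal entries.
  A cutoff \<open>\<phi>\<close> with increments at most \<open>w n / R\<close> satisfies \<open>\<parallel>A (\<phi> f) - \<phi> (A f)\<parallel> \<le> 2 \<parallel>f\<parallel> / R\<close>,
  and divergence of the sum of \<open>w\<close> lets \<open>\<phi>\<close> descend from 1 to 0 for arbitrarily large \<open>R\<close>.
\<close>

theorem generated_operator_eq_maximal:
  assumes A: "tridiagonal A"
    and w: "\<And>n. 0 \<le> w n" "\<not> summable w"
    and Aw: "\<And>n. w n * \<bar>A n (Suc n)\<bar> \<le> 1" "\<And>n. w n * \<bar>A (Suc n) n\<bar> \<le> 1"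
  shows "generated_operator A = maximal_operator A"
proof
  show "generated_operator A \<subseteq> maximal_operator A"
    unfolding generated_operator_def
    by (intro closure_minimal closed_maximal_operator A) (auto simp: maximal_operator_def)
  show "maximal_operator A \<subseteq> generated_operator A"
  proof (rule subrelI)
    fix f g assume "(f, g) \<in> maximal_operator A"
    then have g: "seq g = mapply A (seq f)" by (simp add: maximal_operator_def)
    define s where "s n = (\<Sum>k<n. w k)" for n
    \<comment> \<open>The cutoff decreases linearly in the partial sum \<open>s n\<close>, from 1 at
      \<open>n = 0\<close> to 0 where \<open>s n\<close> reaches \<open>N + 1\<close>. The successor
      keeps the denominator positive.\<close>
    define \<phi> where "\<phi> N n = max 0 (1 - s n / real (Suc N))" for N n
    have s0: "0 \<le> s n" for n unfolding s_def by (intro sum_nonneg w)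
    have \<phi>01: "0 \<le> \<phi> N n" "\<phi> N n \<le> 1" for N n
      using s0[of n] by (auto simp: \<phi>_def)
    have \<phi>lim: "(\<lambda>N. \<phi> N n) \<longlonglongrightarrow> 1" for n
    proof -
      have "(\<lambda>N. max 0 (1 - s n / real (Suc N))) \<longlonglongrightarrow> max 0 (1 - 0)"
        by (intro tendsto_intros filterlim_compose[OF _ filterlim_Suc] tendsto_divide_0[OF tendsto_const]
            filterlim_at_top_imp_at_infinity filterlim_real_sequentially)
      then show ?thesis by (simp add: \<phi>_def)
    qed
    have \<phi>fin: "finite {n. \<phi> N n \<noteq> 0}" for N
    proof -
      \<comment> \<open>Bounded partial sums of non-negative terms would make \<open>w\<close>
        summable.\<close>
      have "\<not> (\<forall>n. s n \<le> real (Suc N))"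
        using w summableI_nonneg_bounded[of w "real (Suc N)"] by (auto simp: s_def)
      then obtain m where m: "s m > real (Suc N)" by (auto simp: not_le)
      have "\<phi> N n = 0" if "m \<le> n" for n
      proof -
        have "s m \<le> s n" unfolding s_def using that w by (intro sum_mono2) auto
        with m have "s n / real (Suc N) \<ge> 1" by (simp add: field_simps)
        then show ?thesis by (simp add: \<phi>_def)
      qed
      then have "{n. \<phi> N n \<noteq> 0} \<subseteq> {..<m}" by (auto simp: not_le[symmetric])
      then show ?thesis by (rule finite_subset) simp
    qed
    have \<phi>step: "\<bar>\<phi> N (Suc n) - \<phi> N n\<bar> \<le> w n / real (Suc N)" for N n
    proof -
      have "s (Suc n) / real (Suc N) = s n / real (Suc N) + w n / real (Suc N)"
        by (simp add: s_def add_divide_distrib)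
      moreover have "0 \<le> w n / real (Suc N)" using w(1)[of n] by simp
      ultimately show ?thesis unfolding \<phi>_def by linarith
    qed
    have step: "\<bar>a\<bar> * \<bar>\<phi> N (Suc n) - \<phi> N n\<bar> \<le> 1 / real (Suc N)" if "w n * \<bar>a\<bar> \<le> 1" for a N n
    proof -
      have "\<bar>a\<bar> * \<bar>\<phi> N (Suc n) - \<phi> N n\<bar> \<le> \<bar>a\<bar> * (w n / real (Suc N))"
        by (intro mult_left_mono \<phi>step) simp
      also have "\<dots> \<le> 1 / real (Suc N)"
        using divide_right_mono[OF that, of "real (Suc N)"] by (simp add: mult.commute)
      finally show ?thesis .
    qed
    define F where "F N = Abs_ell2 (\<lambda>n. of_real (\<phi> N n) * seq f n)" for N
    define K where "K N = Abs_ell2 (\<lambda>n. of_real (\<phi> N n) * seq g n)" for N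
    have \<phi>1: "cmod (of_real (\<phi> N n) * z) \<le> 1 * cmod z" for N n z
      using \<phi>01[of N n] by (simp add: norm_mult mult_left_le_one_le)
    have F: "seq (F N) = (\<lambda>n. of_real (\<phi> N n) * seq f n)" for N
      unfolding F_def by (rule seq_Abs_ell2_dominated[OF \<phi>1])
    have K: "seq (K N) = (\<lambda>n. of_real (\<phi> N n) * seq g n)" for N
      unfolding K_def by (rule seq_Abs_ell2_dominated[OF \<phi>1])
    have Flim: "F \<longlonglongrightarrow> f"
      by (rule cutoff_tendsto[where \<phi> = \<phi>]) (simp_all add: F \<phi>01 \<phi>lim)
    have Klim: "K \<longlonglongrightarrow> g"
      by (rule cutoff_tendsto[where \<phi> = \<phi>]) (simp_all add: K \<phi>01 \<phi>lim)
    have Ffin: "finite {n. seq (F N) n \<noteq> 0}" for N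
      by (rule finite_subset[OF _ \<phi>fin[of N]]) (auto simp: F)
    define H where "H N = Abs_ell2 (mapply A (seq (F N)))" for N
    have H: "seq (H N) = mapply A (seq (F N))" for N
      unfolding H_def by (intro seq_Abs_ell2_finite finite_support_mapply A Ffin)
    \<comment> \<open>\<open>U N\<close> and \<open>V N\<close> are the superdiagonal and
      subdiagonal parts of the commutator \<open>A (\<phi> f) - \<phi> (A f)\<close>; the diagonal
      of \<open>A\<close> cancels. Row 0 has no subdiagonal entry, hence the value 0 in
      \<open>V N\<close>.\<close>
    define U where "U N = Abs_ell2 (\<lambda>n.
      of_real (A n (Suc n) * (\<phi> N (Suc n) - \<phi> N n)) * seq (left_shift f) n)" for N
    define V where "V N = Abs_ell2 (\<lambda>n. case n of 0 \<Rightarrow> 0 | Suc m \<Rightarrow>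
      of_real (A (Suc m) m * (\<phi> N m - \<phi> N (Suc m))) * seq (right_shift f) n)" for N
    have ub: "cmod (of_real (A n (Suc n) * (\<phi> N (Suc n) - \<phi> N n)) * seq (left_shift f) n)
        \<le> 1 / real (Suc N) * cmod (seq (left_shift f) n)" for N n
      unfolding norm_mult norm_of_real abs_mult by (intro mult_right_mono step Aw) simp
    have vb: "cmod (case n of 0 \<Rightarrow> 0 | Suc m \<Rightarrow>
        of_real (A (Suc m) m * (\<phi> N m - \<phi> N (Suc m))) * seq (right_shift f) n)
        \<le> 1 / real (Suc N) * cmod (seq (right_shift f) n)" for N n
    proof (cases n)
      case (Suc m)
      show ?thesis
        unfolding Suc nat.case norm_mult norm_of_real abs_mult abs_minus_commute[of "\<phi> N m"]
        by (intro mult_right_mono step Aw) simp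
    qed simp
    note U = seq_Abs_ell2_dominated[OF ub, folded U_def]
    note V = seq_Abs_ell2_dominated[OF vb, folded V_def]
    have "norm (U N) \<le> 1 / real (Suc N) * norm (left_shift f)" for N
      by (intro norm_ell2_mono) (simp_all only: U ub, simp)
    then have nU: "norm (U N) \<le> 1 / real (Suc N) * norm f" for N
      by (rule order_trans) (intro mult_left_mono norm_left_shift_le, simp)
    have "norm (V N) \<le> 1 / real (Suc N) * norm (right_shift f)" for N
      by (intro norm_ell2_mono) (simp_all only: V vb, simp)
    then have nV: "norm (V N) \<le> 1 / real (Suc N) * norm f" for N
      by (simp only: norm_right_shift)
    have lim0: "(\<lambda>N. 1 / real (Suc N) * norm f) \<longlonglongrightarrow> 0"
      using tendsto_mult_right[OF LIMSEQ_inverse_real_of_nat, of "norm f"] by (simp add: divide_inverse)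
    have Ulim: "U \<longlonglongrightarrow> 0" and Vlim: "V \<longlonglongrightarrow> 0"
      using nU nV by (auto intro!: Lim_null_comparison[OF _ lim0] always_eventually)
    have HKUV: "H N = K N + (U N + V N)" for N
    proof -
      have "seq (H N) n = seq (K N + (U N + V N)) n" for n
        by (cases n) (simp_all add: plus_ell2.rep_eq H K U V F g left_shift.rep_eq right_shift.rep_eq
            mapply_tridiagonal_Suc[OF A] algebra_simps)
      then show ?thesis by (simp add: fun_eq_iff flip: seq_inject)
    qed
    have "(\<lambda>N. K N + (U N + V N)) \<longlonglongrightarrow> g + (0 + 0)"
      by (intro tendsto_add Klim Ulim Vlim)
    then have "H \<longlonglongrightarrow> g" by (simp flip: HKUV)
    with Flim have "(\<lambda>N. (F N, H N)) \<longlonglongrightarrow> (f, g)" by (rule tendsto_Pair)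
    moreover have "(F N, H N) \<in> {(f, g). finite {n. seq f n \<noteq> 0} \<and> seq g = mapply A (seq f)}" for N
      using Ffin H by simp
    ultimately show "(f, g) \<in> generated_operator A"
      unfolding generated_operator_def closure_sequential
      by (intro exI[of _ "\<lambda>N. (F N, H N)"] conjI allI)
  qed
qed

section \<open>Density of the domain, self-adjointness and non-negativity\<close>

lemma closure_Domain_maximal_operator:
  assumes A: "tridiagonal A"
  shows "closure (Domain (maximal_operator A)) = UNIV"
proof -
  have "f \<in> closure (Domain (maximal_operator A))" for f
  proof -
    \<comment> \<open>Density concerns only the domain, not convergence of the images, so a sharp
      truncation is enough.\<close>
    define \<phi> :: "nat \<Rightarrow> nat \<Rightarrow> real" where "\<phi> N n = (if n < N then 1 else 0)" for N n
    define F where "F N = Abs_ell2 (\<lambda>n. of_real (\<phi> N n) * seq f n)" for N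
    have F: "seq (F N) = (\<lambda>n. of_real (\<phi> N n) * seq f n)" for N
      unfolding F_def by (rule seq_Abs_ell2_dominated[where C = 1 and f = f]) (simp add: \<phi>_def)
    have "(\<lambda>N. \<phi> N n) \<longlonglongrightarrow> 1" for n
      by (rule tendsto_eventually) (auto simp: \<phi>_def eventually_at_top_dense intro: exI[of _ n])
    then have "F \<longlonglongrightarrow> f"
      by (intro cutoff_tendsto[of \<phi>]) (simp_all add: F, simp_all add: \<phi>_def)
    moreover have "F N \<in> Domain (maximal_operator A)" for N
    proof -
      have "finite {n. seq (F N) n \<noteq> 0}"
        by (rule finite_subset[of _ "{..<N}"]) (auto simp: F \<phi>_def)
      then show ?thesis using finite_support_in_maximal_operator[OF A] by blast
    qed
    ultimately show ?thesis unfolding closure_sequential by blast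
  qed
  then show ?thesis by blast
qed

text \<open>The assumption \<open>sym\<close> says that the real matrix \<open>G A\<close> is
  symmetric. Finite support of \<open>f\<close> alone reduces the double sum to a finite rectangle,
  where the order of summation can be exchanged; \<open>g\<close> is an arbitrary vector of the
  maximal domain.\<close>

lemma krein_inner_mapply_finite:
  assumes A: "tridiagonal A" and G: "sign_matrix G"
    and sym: "\<And>i j. G i i * A i j = G j j * A j i"
    and f: "finite {n. seq f n \<noteq> 0}" "seq k = mapply A (seq f)"
    and h: "seq h = mapply A (seq g)"
  shows "krein_inner G k g = krein_inner G f h"
proof -
  obtain m where m: "seq f n = 0" if "n > m" for n
    using f(1) by (auto simp: finite_nat_set_iff_bounded_le not_le[symmetric])
  have z: "A i j = 0" if "j > Suc i \<or> i > Suc j" for i j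
    using A that by (auto simp: tridiagonal_def)
  \<comment> \<open>One common column range for all rows up to \<open>Suc m\<close>, the only rows
    in which \<open>k\<close> can be nonzero.\<close>
  have ext: "mapply A x n = (\<Sum>j\<le>Suc (Suc m). of_real (A n j) * x j)"
    if "n \<le> Suc m" for x n
    unfolding mapply_tridiagonal[OF A] using that z by (intro sum.mono_neutral_left) auto
  have k0: "seq k n = 0" if "n > Suc m" for n
    unfolding f(2) mapply_tridiagonal[OF A] using m z that
    by (intro sum.neutral)
      (metis (no_types) mult_zero_left mult_zero_right of_real_0 not_less_eq
        less_trans_Suc)
  have "krein_inner G k g = (\<Sum>n\<le>Suc m. of_real (G n n) * seq k n * cnj (seq g n))"
    unfolding krein_inner_eq[OF G] using k0 by (intro suminf_finite) auto
  also have "\<dots> = (\<Sum>n\<le>Suc m. \<Sum>j\<le>m. of_real (G n n * A n j) * seq f j * cnj (seq g n))"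
  proof (intro sum.cong refl)
    fix n assume "n \<in> {..Suc m}"
    then have "seq k n = (\<Sum>j\<le>m. of_real (A n j) * seq f j)"
      unfolding f(2) using m by (subst ext) (auto intro!: sum.mono_neutral_right)
    then show "of_real (G n n) * seq k n * cnj (seq g n) =
        (\<Sum>j\<le>m. of_real (G n n * A n j) * seq f j * cnj (seq g n))"
      by (simp add: sum_distrib_left sum_distrib_right mult.assoc del: sum.atMost_Suc)
  qed
  also have "\<dots> = (\<Sum>j\<le>m. \<Sum>n\<le>Suc m. of_real (G j j) * seq f j * cnj (of_real (A j n) * seq g n))"
    by (subst sum.swap, intro sum.cong refl, subst sym) simp
  also have "\<dots> = (\<Sum>j\<le>m. of_real (G j j) * seq f j * cnj (seq h j))"
  proof (intro sum.cong refl)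
    fix j assume "j \<in> {..m}"
    then have "seq h j = (\<Sum>n\<le>Suc m. of_real (A j n) * seq g n)"
      unfolding h mapply_tridiagonal[OF A] using z by (intro sum.mono_neutral_left) auto
    then show "(\<Sum>n\<le>Suc m. of_real (G j j) * seq f j * cnj (of_real (A j n) * seq g n)) =
        of_real (G j j) * seq f j * cnj (seq h j)"
      by (simp only: cnj_sum sum_distrib_left)
  qed
  also have "\<dots> = krein_inner G f h"
    unfolding krein_inner_eq[OF G] using m by (intro suminf_finite[symmetric]) (auto simp: not_le)
  finally show ?thesis .
qed

theorem krein_self_adjoint_generated_operator:
  assumes A: "tridiagonal A" and G: "sign_matrix G"
    and sym: "\<And>i j. G i i * A i j = G j j * A j i"
    and eq: "generated_operator A = maximal_operator A"
  shows "krein_self_adjoint G (generated_operator A)"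
proof -
  let ?T = "maximal_operator A"
  interpret bounded_bilinear "krein_inner G" by (rule bounded_bilinear_krein_inner[OF G])
  have "?T \<subseteq> krein_adjoint G ?T"
  proof (rule subrelI)
    fix g h assume gh: "(g, h) \<in> ?T"
    \<comment> \<open>With \<open>(g, h)\<close> fixed, the adjoint relation is a closed condition
      on the other pair. It holds for finitely supported vectors, hence on the closure of their
      graph, which by \<open>eq\<close> is all of \<open>?T\<close>.\<close>
    have "closed {p. krein_inner G (snd p) g = krein_inner G (fst p) h}"
      by (intro closed_Collect_eq continuous_on continuous_intros)
    then have "generated_operator A \<subseteq> {p. krein_inner G (snd p) g = krein_inner G (fst p) h}"
      unfolding generated_operator_def using gh
      by (intro closure_minimal)
        (auto simp: maximal_operator_def intro!: krein_inner_mapply_finite[OF A G sym])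
    then show "(g, h) \<in> krein_adjoint G ?T"
      unfolding eq krein_adjoint_def by auto
  qed
  moreover have "krein_adjoint G ?T \<subseteq> ?T"
  proof (rule subrelI)
    fix g h assume gh: "(g, h) \<in> krein_adjoint G ?T"
    have "seq h n = mapply A (seq g) n" for n
    proof -
      \<comment> \<open>Testing the adjoint relation against the \<open>n\<close>-th unit vector
        reads off the \<open>n\<close>-th coordinate of \<open>h\<close>.\<close>
      define e where "e = Abs_ell2 (\<lambda>i. if i = n then 1 else 0)"
      have e: "seq e = (\<lambda>i. if i = n then 1 else 0)"
        unfolding e_def by (rule seq_Abs_ell2_finite) simp
      have fin: "finite {i. seq e i \<noteq> 0}" by (simp add: e)
      define k where "k = Abs_ell2 (mapply A (seq e))"
      have k: "seq k = (\<lambda>i. of_real (A i n))"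
        unfolding k_def seq_Abs_ell2_finite[OF finite_support_mapply[OF A fin]]
        by (rule ext, unfold mapply_def e, subst suminf_finite[of "{n}"]) auto
      have "krein_inner G k g = krein_inner G e h"
        using gh finite_support_in_maximal_operator[OF A fin]
        unfolding krein_adjoint_def k_def by blast
      moreover have "krein_inner G e h = of_real (G n n) * cnj (seq h n)"
        unfolding krein_inner_eq[OF G] by (subst suminf_finite[of "{n}"]) (auto simp: e)
      moreover have "krein_inner G k g = (\<Sum>i\<le>Suc n. of_real (G i i * A i n) * cnj (seq g i))"
        unfolding krein_inner_eq[OF G] k using A
        by (subst suminf_finite[of "{..Suc n}"]) (auto simp: tridiagonal_def)
      moreover have "\<dots> = of_real (G n n) * cnj (mapply A (seq g) n)"
        unfolding sym[of _ n] mapply_tridiagonal[OF A]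
        by (simp add: sum_distrib_left algebra_simps)
      ultimately have "of_real (G n n) * cnj (seq h n) = of_real (G n n) * cnj (mapply A (seq g) n)"
        by simp
      moreover have "G n n \<noteq> 0" using sign_matrix_diag[OF G, of n] by auto
      ultimately show ?thesis by simp
    qed
    then show "(g, h) \<in> ?T" by (simp add: maximal_operator_def fun_eq_iff)
  qed
  moreover have "single_valued ?T"
    by (rule single_valuedI)
      (metis (mono_tags, lifting) case_prodD maximal_operator_def mem_Collect_eq seq_inject)
  ultimately show ?thesis
    unfolding krein_self_adjoint_def eq using closure_Domain_maximal_operator[OF A] by blast
qed

lemma krein_nonneg_generated_operator:
  assumes G: "sign_matrix G"
    and fin: "\<And>f g. finite {n. seq f n \<noteq> 0} \<Longrightarrow> seq g = mapply A (seq f) \<Longrightarrow>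
      krein_inner G (g - c *\<^sub>R f) f \<in> \<real>\<^sub>\<ge>\<^sub>0"
  shows "krein_nonneg G (shift_operator (generated_operator A) c)"
proof -
  interpret bounded_bilinear "krein_inner G" by (rule bounded_bilinear_krein_inner[OF G])
  have "closed ((\<lambda>p. krein_inner G (snd p - c *\<^sub>R fst p) (fst p)) -` \<real>\<^sub>\<ge>\<^sub>0)"
    by (intro closed_vimage closed_nonneg_Reals_complex continuous_on continuous_intros)
  then have "generated_operator A \<subseteq> (\<lambda>p. krein_inner G (snd p - c *\<^sub>R fst p) (fst p)) -` \<real>\<^sub>\<ge>\<^sub>0"
    unfolding generated_operator_def by (intro closure_minimal) (auto intro: fin)
  then show ?thesis
    by (force simp: krein_nonneg_def shift_operator_def)
qed

section \<open>The shifted Darboux transformation\<close>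

text \<open>Column \<open>i\<close> of \<open>L\<close> is supported in rows \<open>i\<close> and
  \<open>i + 1\<close>, so the inner product of columns \<open>i\<close> and \<open>j\<close> has at
  most two terms.\<close>

lemma shifted_Darboux_entry:
  assumes L: "lower_bidiagonal L" and G: "sign_matrix G"
  shows "shifted_Darboux x L G i j =
    G i i * (L i i * L i j + L (Suc i) i * L (Suc i) j) + (if i = j then x else 0)"
proof -
  have GL: "(G \<star> mtranspose L) i k = G i i * L k i" for k
    unfolding mmult_def mtranspose_def using G
    by (subst suminf_finite[of "{i}"]) (auto simp: sign_matrix_def)
  have "(G \<star> mtranspose L \<star> L) i j = (\<Sum>k\<in>{i, Suc i}. G i i * L k i * L k j)"
    unfolding mmult_def[of "G \<star> mtranspose L"] GL using L
    by (intro suminf_finite) (auto simp: lower_bidiagonal_def)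
  then show ?thesis
    by (simp add: shifted_Darboux_def madd_def scalar_mat_def algebra_simps)
qed

lemma shifted_Darboux_entries:
  assumes L: "lower_bidiagonal L" and G: "sign_matrix G"
  shows "shifted_Darboux x L G i i = G i i * ((L i i)\<^sup>2 + (L (Suc i) i)\<^sup>2) + x"
    and "shifted_Darboux x L G i (Suc i) = G i i * (L (Suc i) i * L (Suc i) (Suc i))"
    and "shifted_Darboux x L G (Suc i) i = G (Suc i) (Suc i) * (L (Suc i) i * L (Suc i) (Suc i))"
    and "i \<noteq> j \<Longrightarrow> i \<noteq> Suc j \<Longrightarrow> j \<noteq> Suc i \<Longrightarrow> shifted_Darboux x L G i j = 0"
proof -
  have z: "L a b = 0" if "a \<noteq> b" "a \<noteq> Suc b" for a b
    using L that by (simp add: lower_bidiagonal_def)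
  show "shifted_Darboux x L G i i = G i i * ((L i i)\<^sup>2 + (L (Suc i) i)\<^sup>2) + x"
    and "shifted_Darboux x L G i (Suc i) = G i i * (L (Suc i) i * L (Suc i) (Suc i))"
    and "shifted_Darboux x L G (Suc i) i = G (Suc i) (Suc i) * (L (Suc i) i * L (Suc i) (Suc i))"
    and "i \<noteq> j \<Longrightarrow> i \<noteq> Suc j \<Longrightarrow> j \<noteq> Suc i \<Longrightarrow> shifted_Darboux x L G i j = 0"
    by (simp_all add: shifted_Darboux_entry[OF L G] z power2_eq_square)
qed

lemma tridiagonal_shifted_Darboux:
  "lower_bidiagonal L \<Longrightarrow> sign_matrix G \<Longrightarrow> tridiagonal (shifted_Darboux x L G)"
  by (simp add: tridiagonal_def shifted_Darboux_entries)

text \<open>Since \<open>G\<close> squares to the identity, multiplying the transformation by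
  \<open>G\<close> gives \<open>L\<^sup>T L + x G\<close>, which is symmetric.\<close>

lemma shifted_Darboux_krein_symmetric:
  assumes L: "lower_bidiagonal L" and G: "sign_matrix G"
  shows "G i i * shifted_Darboux x L G i j = G j j * shifted_Darboux x L G j i"
proof -
  note e = shifted_Darboux_entries[OF L G]
  have GG: "G k k * (G k k * a) = a" for k a
    by (simp add: sign_matrix_sq[OF G] flip: mult.assoc)
  consider "i = j" | "i = Suc j" | "j = Suc i" | "i \<noteq> j" "i \<noteq> Suc j" "j \<noteq> Suc i" by blast
  then show ?thesis
    by cases (simp_all only: e(2,3) GG, simp add: e(4))
qed

text \<open>
  Summation by parts gives \<open>(L\<^sup>T L f, f) = \<parallel>L f\<parallel>\<^sup>2\<close>, where \<open>v = L f\<close>.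
\<close>

lemma krein_inner_shifted_Darboux_nonneg:
  assumes L: "lower_bidiagonal L" and G: "sign_matrix G"
    and f: "finite {n. seq f n \<noteq> 0}" and g: "seq g = mapply (shifted_Darboux x L G) (seq f)"
  shows "krein_inner G (g - x *\<^sub>R f) f \<in> \<real>\<^sub>\<ge>\<^sub>0"
proof -
  note e = shifted_Darboux_entries[OF L G] and A = tridiagonal_shifted_Darboux[OF L G]
  define v where "v k = of_real (L k k) * seq f k +
    (case k of 0 \<Rightarrow> 0 | Suc m \<Rightarrow> of_real (L k m) * seq f m)" for k
  \<comment> \<open>Here \<open>G (g - x f) = L\<^sup>T v\<close>, because the sign \<open>G\<close>
    in front of \<open>L\<^sup>T L\<close> squares to 1.\<close>
  have Gv: "of_real (G n n) * seq (g - x *\<^sub>R f) n = of_real (L n n) * v n + of_real (L (Suc n) n) * v (Suc n)"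
    for n
  proof -
    have "seq (g - x *\<^sub>R f) n = of_real (G n n) * (of_real (L n n) * v n + of_real (L (Suc n) n) * v (Suc n))"
    proof (cases n)
      case 0
      show ?thesis
        unfolding 0 One_nat_def minus_ell2.rep_eq scaleR_ell2.rep_eq g
          mapply_tridiagonal_Suc[OF A] e(1,2) v_def nat.case
        by (simp add: scaleR_conv_of_real algebra_simps power2_eq_square)
    next
      case (Suc m)
      show ?thesis
        unfolding Suc minus_ell2.rep_eq scaleR_ell2.rep_eq g
          mapply_tridiagonal_Suc[OF A] e(1-3) v_def nat.case
        by (simp add: scaleR_conv_of_real algebra_simps power2_eq_square)
    qed
    moreover have "of_real (G n n) * (of_real (G n n) * z) = z" for z :: complex
      by (simp add: sign_matrix_sq[OF G] flip: mult.assoc of_real_mult)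
    ultimately show ?thesis by simp
  qed
  have parts: "(\<Sum>n\<le>m. of_real (G n n) * seq (g - x *\<^sub>R f) n * cnj (seq f n)) =
      (\<Sum>n\<le>m. v n * cnj (v n)) + of_real (L (Suc m) m) * v (Suc m) * cnj (seq f m)" for m
  proof (induction m)
    case 0
    show ?case unfolding Gv by (simp add: v_def[of 0] algebra_simps)
  next
    case (Suc m)
    have "cnj (v (Suc m)) = of_real (L (Suc m) (Suc m)) * cnj (seq f (Suc m)) +
        of_real (L (Suc m) m) * cnj (seq f m)"
      by (simp add: v_def)
    then show ?case unfolding sum.atMost_Suc Suc.IH Gv[of "Suc m"] by (simp add: algebra_simps)
  qed
  \<comment> \<open>Vanishing already at index \<open>m\<close> is needed: it removes the boundary
    term in \<open>parts\<close>.\<close>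
  obtain m where m: "seq f n = 0" if "n \<ge> m" for n
    using f by (auto simp: finite_nat_set_iff_bounded not_less[symmetric])
  have "krein_inner G (g - x *\<^sub>R f) f = (\<Sum>n\<le>m. of_real (G n n) * seq (g - x *\<^sub>R f) n * cnj (seq f n))"
    unfolding krein_inner_eq[OF G] using m by (intro suminf_finite) auto
  also have "\<dots> = (\<Sum>n\<le>m. v n * cnj (v n))"
    unfolding parts using m[of m] by simp
  also have "\<dots> = of_real (\<Sum>n\<le>m. (cmod (v n))\<^sup>2)"
    by (simp only: of_real_sum complex_norm_square)
  also have "\<dots> \<in> \<real>\<^sub>\<ge>\<^sub>0"
    by (simp only: nonneg_Reals_of_real_iff) (simp add: sum_nonneg)
  finally show ?thesis .
qed

section \<open>Explicit pivots and Carleman's condition for the transformation\<close>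

text \<open>Eliminating the subdiagonal of \<open>L\<close> gives a continued fraction recurrence
  for the pivots, which the Chebyshev recurrence of \<open>c n = cos (n \<pi> \<alpha>)\<close>
  solves. Irrationality keeps every \<open>c n\<close> nonzero. The exceptional factor at
  \<open>n = 0\<close> reflects the first off-diagonal entry \<open>1 / sqrt 2\<close> of
  \<open>J0\<close>.\<close>

lemma LGL_factorization_J0_diag:
  assumes irr: "\<alpha> \<notin> \<rat>" and LGL: "LGL_factorization J0 (cos (pi * \<alpha>)) L G"
  shows "(L n n)\<^sup>2 * G n n =
    - cos (real (Suc n) * (pi * \<alpha>)) / ((if n = 0 then 1 else 2) * cos (real n * (pi * \<alpha>)))"
proof -
  define c where "c n = cos (real n * (pi * \<alpha>))" for n
  note LGL' = LGL[unfolded LGL_factorization_J0_iff]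
  have G: "sign_matrix G" using LGL' by blast
  have pos: "L i i > 0" for i using LGL' by blast
  have c: "c n \<noteq> 0" for n
    using cos_irrational_nonzero[OF irr, of n] by (cases n) (auto simp: c_def)
  have crec: "c (Suc (Suc n)) = 2 * c 1 * c (Suc n) - c n" for n
  proof -
    have "c (Suc (Suc n)) = cos (real (Suc n) * (pi * \<alpha>) + pi * \<alpha>)"
      "c n = cos (real (Suc n) * (pi * \<alpha>) - pi * \<alpha>)"
      by (simp_all add: c_def algebra_simps)
    then show ?thesis by (simp add: cos_add cos_diff c_def)
  qed
  define D where "D n = (L n n)\<^sup>2 * G n n" for n
  have D0: "D 0 = - c 1" using LGL' by (simp add: D_def c_def)
  have Drec: "D (Suc n) = - c 1 - (J0 (Suc n) n)\<^sup>2 / D n" for n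
  proof -
    have "J0 (Suc n) n = L (Suc n) n * G n n * L n n" using LGL' by simp
    then have "(J0 (Suc n) n)\<^sup>2 = (L (Suc n) n)\<^sup>2 * G n n * D n"
      by (simp only: D_def power2_eq_square mult_ac)
    moreover have "D n \<noteq> 0"
      using pos[of n] sign_matrix_diag[OF G, of n] by (auto simp: D_def)
    ultimately have "(J0 (Suc n) n)\<^sup>2 / D n = (L (Suc n) n)\<^sup>2 * G n n" by simp
    moreover have "(L (Suc n) n)\<^sup>2 * G n n + D (Suc n) = - c 1"
      using LGL' by (simp add: D_def c_def)
    ultimately show ?thesis by linarith
  qed
  have "D n = - c (Suc n) / ((if n = 0 then 1 else 2) * c n)"
  proof (induction n)
    case 0
    show ?case using D0 by (simp add: c_def)
  next
    case (Suc n)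
    have c0: "c 0 = 1" by (simp add: c_def)
    show ?case
      using c[of n] c[of "Suc n"] c0 unfolding Drec Suc.IH crec[of n]
      by (cases n) (simp_all add: J0_entries power_divide field_simps)
  qed
  then show ?thesis by (simp add: D_def c_def)
qed

text \<open>The cosine cancels the possibly small denominator of the off-diagonal entry: the square
  of the product is \<open>\<bar>c (n + 2)\<bar> * \<bar>c n\<bar> / 4\<close>, at most
  \<open>1 / 4\<close>.\<close>

lemma shifted_Darboux_offdiag_bound:
  assumes irr: "\<alpha> \<notin> \<rat>" and LGL: "LGL_factorization J0 (cos (pi * \<alpha>)) L G"
  shows "\<bar>cos (real (Suc n) * (pi * \<alpha>))\<bar> * \<bar>L (Suc n) n * L (Suc n) (Suc n)\<bar> \<le> 1"
proof -
  define c where "c n = cos (real n * (pi * \<alpha>))" for n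
  note LGL' = LGL[unfolded LGL_factorization_J0_iff]
  have G: "sign_matrix G" using LGL' by blast
  have c: "c n \<noteq> 0" for n
    using cos_irrational_nonzero[OF irr, of n] by (cases n) (auto simp: c_def)
  have c1: "\<bar>c n\<bar> \<le> 1" for n by (simp add: c_def)
  have c0: "c 0 = 1" by (simp add: c_def)
  have L2: "(L n n)\<^sup>2 = \<bar>c (Suc n)\<bar> / ((if n = 0 then 1 else 2) * \<bar>c n\<bar>)" for n
  proof -
    have "(L n n)\<^sup>2 = \<bar>(L n n)\<^sup>2 * G n n\<bar>"
      by (simp add: abs_mult sign_matrix_diag[OF G])
    also have "\<dots> = \<bar>c (Suc n)\<bar> / ((if n = 0 then 1 else 2) * \<bar>c n\<bar>)"
      unfolding LGL_factorization_J0_diag[OF irr LGL] by (simp add: abs_mult c_def)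
    finally show ?thesis .
  qed
  have "J0 (Suc n) n = L (Suc n) n * G n n * L n n" using LGL' by simp
  then have "(L (Suc n) n)\<^sup>2 * (G n n * G n n) * (L n n)\<^sup>2 = (J0 (Suc n) n)\<^sup>2"
    by (simp only: power2_eq_square mult_ac)
  then have off: "(L (Suc n) n)\<^sup>2 * (L n n)\<^sup>2 = (J0 (Suc n) n)\<^sup>2"
    by (simp add: sign_matrix_sq[OF G])
  have "L n n \<noteq> 0" using LGL' by (metis less_irrefl)
  then have "(L (Suc n) n)\<^sup>2 = (J0 (Suc n) n)\<^sup>2 / (L n n)\<^sup>2"
    using off by (simp add: field_simps)
  then have "(c (Suc n) * (L (Suc n) n * L (Suc n) (Suc n)))\<^sup>2 =
      (c (Suc n))\<^sup>2 * ((J0 (Suc n) n)\<^sup>2 / (L n n)\<^sup>2 * (L (Suc n) (Suc n))\<^sup>2)"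
    by (simp add: power_mult_distrib)
  \<comment> \<open>The formula also covers \<open>n = 0\<close>: there
    \<open>(J0 1 0)\<^sup>2\<close> is \<open>1 / 2\<close> instead of \<open>1 / 4\<close>, which
    offsets the missing factor 2 in the first pivot.\<close>
  also have "\<dots> = \<bar>c (Suc (Suc n))\<bar> * \<bar>c n\<bar> / 4"
    unfolding L2 using c[of n] c[of "Suc n"] c0
    by (cases n) (auto simp: J0_entries power_divide field_simps power2_eq_square abs_mult_self_eq)
  also have "\<dots> \<le> 1 * 1 / 4"
    by (intro divide_right_mono mult_mono c1) auto
  also have "\<dots> \<le> 1\<^sup>2" by simp
  finally have "\<bar>c (Suc n) * (L (Suc n) n * L (Suc n) (Suc n))\<bar> \<le> 1"
    by (simp only: abs_le_square_iff[symmetric] abs_one)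
  then show ?thesis by (simp only: abs_mult c_def)
qed

text \<open>Summability would force \<open>cos (n t)\<close> to tend to 0, but then
  \<open>cos (2 n t) = 2 (cos (n t))\<^sup>2 - 1\<close> would tend to -1.\<close>

lemma not_summable_cos_multiples: "\<not> summable (\<lambda>n. \<bar>cos (real (Suc n) * t)\<bar>)"
proof
  assume "summable (\<lambda>n. \<bar>cos (real (Suc n) * t)\<bar>)"
  then have "summable (\<lambda>n. cos (real (Suc n) * t))" by (rule summable_rabs_cancel)
  then have "(\<lambda>n. cos (real (Suc n) * t)) \<longlonglongrightarrow> 0" by (rule summable_LIMSEQ_zero)
  then have lim: "(\<lambda>n. cos (real n * t)) \<longlonglongrightarrow> 0" by (subst (asm) filterlim_sequentially_Suc)
  have "(\<lambda>n. cos (real (2 * n) * t)) \<longlonglongrightarrow> 0"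
    using LIMSEQ_subseq_LIMSEQ[OF lim, of "\<lambda>n. 2 * n"] by (simp add: strict_mono_def o_def)
  moreover have "(\<lambda>n. 2 * (cos (real n * t))\<^sup>2 - 1) \<longlonglongrightarrow> 2 * 0\<^sup>2 - 1"
    by (intro tendsto_intros lim)
  moreover have "cos (real (2 * n) * t) = 2 * (cos (real n * t))\<^sup>2 - 1" for n
    using cos_double_cos[of "real n * t"] by (simp add: mult.assoc)
  ultimately have "(0::real) = 2 * 0\<^sup>2 - 1"
    using LIMSEQ_unique by (simp only:)
  then show False by simp
qed

theorem theorem3p2:
  fixes \<alpha> :: real and L G :: smat
  assumes "0 < \<alpha>" and "\<alpha> < 1" and "\<alpha> \<notin> \<rat>"
    and "LGL_factorization J0 (cos (pi * \<alpha>)) L G"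
  shows "krein_self_adjoint G (generated_operator (shifted_Darboux (cos (pi * \<alpha>)) L G)) \<and>
    krein_nonneg G
      (shift_operator (generated_operator (shifted_Darboux (cos (pi * \<alpha>)) L G)) (cos (pi * \<alpha>)))"
proof
  have L: "lower_bidiagonal L" and G: "sign_matrix G"
    using assms(4) by (auto simp: LGL_factorization_def)
  let ?A = "shifted_Darboux (cos (pi * \<alpha>)) L G"
  note A = tridiagonal_shifted_Darboux[OF L G] and e = shifted_Darboux_entries[OF L G]
  \<comment> \<open>The two off-diagonal entries at position \<open>n\<close> differ only by signs
    from \<open>G\<close>, so one estimate bounds both.\<close>
  have bound: "\<bar>cos (real (Suc n) * (pi * \<alpha>))\<bar> * \<bar>?A n (Suc n)\<bar> \<le> 1"
    "\<bar>cos (real (Suc n) * (pi * \<alpha>))\<bar> * \<bar>?A (Suc n) n\<bar> \<le> 1" for n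
    using shifted_Darboux_offdiag_bound[OF assms(3,4), of n]
    unfolding e abs_mult[of "G _ _"] sign_matrix_diag[OF G] by simp_all
  have "generated_operator ?A = maximal_operator ?A"
    using A not_summable_cos_multiples bound
    by (intro generated_operator_eq_maximal[where w = "\<lambda>n. \<bar>cos (real (Suc n) * (pi * \<alpha>))\<bar>"]) auto
  then show "krein_self_adjoint G (generated_operator ?A)"
    by (intro krein_self_adjoint_generated_operator A G shifted_Darboux_krein_symmetric L)
  show "krein_nonneg G (shift_operator (generated_operator ?A) (cos (pi * \<alpha>)))"
    by (rule krein_nonneg_generated_operator[OF G], rule krein_inner_shifted_Darboux_nonneg[OF L G])
qed

end
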